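(* The subspace of $\textsf{ParSym}$ spanned by $\{\textsf{H}_\pi : \pi \text{ a partial permutation}\}$ is a Hopf subalgebra of $\textsf{ParSym}$: it contains $\textsf{H}_\varnothing$, is closed under the product, $\Delta$ maps it into its tensor square, and the antipode $S$ maps it into itself.
   Context: Partition diagrams of order $k$ are set partitions of $\{1,\ldots,k,1',\ldots,k'\}$; $A_0=\{\varnothing\}$. A partial permutation is a partition diagram each of whose blocks has size one or two, such that every block of size two contains one element of $\{1,\ldots,k\}$ and one element of $\{1',\ldots,k'\}$. For $\pi$ of order $k$, $\rho$ of order $l$: $\pi\otimes\rho$ has as blocks those of $\pi$ and those of $\rho$ shifted ($i\mapsto i+k$, $i'\mapsto(i+k)'$). A diagram is $\otimes$-irreducible if it is not $\rho^{(1)}\otimes\rho^{(2)}$ with both factors nonempty. For nonempty $\pi,\rho$ (orders $k,l$), $\pi\bullet\rho$ is obtained from $\pi\otimes\rho$ by merging the block containing $k'$ with the block containing $(k+1)'$; $\varnothing\bullet\rho=\rho$, $\pi\bullet\varnothing=\pi$. Over a field $\mathbbm{k}$, $\textsf{ParSym}$ has basis $\{\textsf{H}_\pi\}$ over all partition diagrams, product $\textsf{H}_\pi\textsf{H}_\rho=\textsf{H}_{\pi\otimes\rho}$, unit $\textsf{H}_\varnothing$ (free on $\textsf{H}_\pi$, $\pi$ nonempty $\otimes$-irreducible). $\Delta$ is the algebra morphism with $\Delta\textsf{H}_\varnothing=\textsf{H}_\varnothing\otimes\textsf{H}_\varnothing$ and $\Delta\textsf{H}_\pi=\sum\textsf{H}_{G_1}\otimes\textsf{H}_{G_2}$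 for nonempty $\otimes$-irreducible $\pi$, over ordered pairs $(G_1,G_2)$, each $\varnothing$ or $\otimes$-irreducible, with $G_1\bullet G_2=\pi$. $S$ is the linear antimorphism with $S(\textsf{H}_\varnothing)=\textsf{H}_\varnothing$ and $S(\textsf{H}_\pi)=\sum(-1)^\ell\textsf{H}_{\rho^{(1)}}\cdots\textsf{H}_{\rho^{(\ell)}}$ for nonempty $\otimes$-irreducible $\pi$, over tuples of nonempty diagrams with $\rho^{(1)}\bullet\cdots\bullet\rho^{(\ell)}=\pi$. *)

theory Defs
  imports Complex_Main "HOL-Library.Disjoint_Sets" "HOL-Library.Poly_Mapping"
    "HOL-Library.Product_Plus"
begin

section \<open>Partition diagrams\<close>

text \<open>\<open>Top i\<close> stands for the element $i$ and \<open>Bot i\<close> for the element $i'$.\<close>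

datatype vertex = Top nat | Bot nat

definition vertices :: "nat \<Rightarrow> vertex set" where
  "vertices k = Top ` {1..k} \<union> Bot ` {1..k}"

fun shift :: "nat \<Rightarrow> vertex \<Rightarrow> vertex" where
  "shift k (Top i) = Top (i + k)"
| "shift k (Bot i) = Bot (i + k)"

typedef diagram = "{(k, P). partition_on (vertices k) P}"
  by (rule exI[of _ "(0, {})"]) (simp add: vertices_def partition_on_empty)

setup_lifting type_definition_diagram

lift_definition order :: "diagram \<Rightarrow> nat" is fst .

lift_definition blocks :: "diagram \<Rightarrow> vertex set set" is snd .

lemma partition_on_blocks: "partition_on (vertices (order d)) (blocks d)"
  by transfer auto

lemma diagram_eqI: "order a = order b \<Longrightarrow> blocks a = blocks b \<Longrightarrow> a = b"
  by transfer auto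

lemma inj_shift: "inj (shift k)"
proof (rule injI)
  fix x y show "shift k x = shift k y \<Longrightarrow> x = y" by (cases x; cases y) auto
qed

lemma shift_vertices_disjoint: "v \<in> vertices l \<Longrightarrow> shift k v \<notin> vertices k"
  by (auto simp: vertices_def)

lemma shift_in_vertices_iff:
  "v \<in> vertices l \<Longrightarrow> shift k v \<in> vertices (k + m) \<longleftrightarrow> v \<in> vertices m"
  by (auto simp: vertices_def image_iff)

lemma shift_shift: "shift k (shift l v) = shift (l + k) v"
  by (cases v) auto

lemma vertices_add: "vertices (k + l) = vertices k \<union> shift k ` vertices l"
proof -
  have i: "{1..k + l} = {1..k} \<union> (\<lambda>i. i + k) ` {1..l}"
    by (simp add: image_add_atLeastAtMost' add.commute ivl_disj_un_two_touch) auto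
  have s: "shift k ` Top ` X = Top ` (\<lambda>i. i + k) ` X" "shift k ` Bot ` X = Bot ` (\<lambda>i. i + k) ` X" for X
    by (simp_all add: image_image)
  show ?thesis unfolding vertices_def i by (simp only: image_Un s Un_ac)
qed

lemma partition_on_tensor:
  assumes P: "partition_on (vertices k) P" and Q: "partition_on (vertices l) Q"
  shows "partition_on (vertices (k + l)) (P \<union> (`) (shift k) ` Q)"
proof (rule partition_onI)
  have UP: "\<Union>P = vertices k" and UQ: "\<Union>Q = vertices l"
    using P Q by (auto simp: partition_on_def)
  show "\<Union>(P \<union> (`) (shift k) ` Q) = vertices (k + l)"
    by (simp only: Union_Un_distrib UP image_Union[symmetric] UQ vertices_add)
  show "{} \<notin> P \<union> (`) (shift k) ` Q" using P Q by (auto simp: partition_on_def)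
  have m: "disjnt p (shift k ` q)" if "p \<in> P" "q \<in> Q" for p q
  proof -
    have "p \<subseteq> vertices k" "q \<subseteq> vertices l" using that UP UQ by auto
    then show ?thesis using shift_vertices_disjoint unfolding disjnt_def by blast
  qed
  fix p q assume pq: "p \<in> P \<union> (`) (shift k) ` Q" "q \<in> P \<union> (`) (shift k) ` Q" "p \<noteq> q"
  have dP: "\<And>a b. a \<in> P \<Longrightarrow> b \<in> P \<Longrightarrow> a \<noteq> b \<Longrightarrow> disjnt a b"
    and dQ: "\<And>a b. a \<in> Q \<Longrightarrow> b \<in> Q \<Longrightarrow> a \<noteq> b \<Longrightarrow> disjnt a b"
    using P Q by (auto simp: partition_on_def pairwise_def)
  have sQ: "disjnt (shift k ` a) (shift k ` b)" if "a \<in> Q" "b \<in> Q" "shift k ` a \<noteq> shift k ` b" for a b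
  proof -
    have "disjnt a b" using that dQ by blast
    then show ?thesis by (auto simp: disjnt_def dest!: injD[OF inj_shift])
  qed
  from pq(1,2) consider "p \<in> P" "q \<in> P"
    | b where "p \<in> P" "b \<in> Q" "q = shift k ` b"
    | a where "a \<in> Q" "p = shift k ` a" "q \<in> P"
    | a b where "a \<in> Q" "p = shift k ` a" "b \<in> Q" "q = shift k ` b" by blast
  then show "disjnt p q"
  proof cases
    case 1 then show ?thesis using dP pq(3) by blast
  next
    case 2 then show ?thesis using m by simp
  next
    case 3 then show ?thesis using m by (simp add: disjnt_sym)
  next
    case 4 then show ?thesis using sQ pq(3) by simp
  qed
qed

text \<open>The monoid structure on diagrams: \<open>\<pi> + \<rho>\<close> is $\pi \otimes \rho$ and \<open>0\<close> is $\varnothing$.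
  The additive notation is used because then the library's product on
  \<open>_ \<Rightarrow>\<^sub>0 _\<close> is that of the monoid algebra, i.e. $H_\pi H_\rho = H_{\pi\otimes\rho}$.\<close>

instantiation diagram :: monoid_add
begin

lift_definition zero_diagram :: diagram is "(0, {})"
  by (simp add: vertices_def partition_on_empty)

lift_definition plus_diagram :: "diagram \<Rightarrow> diagram \<Rightarrow> diagram" is
  "\<lambda>(k, P) (l, Q). (k + l, P \<union> (`) (shift k) ` Q)"
  by (auto simp: partition_on_tensor)

instance
proof
  fix a b c :: diagram
  show "a + b + c = a + (b + c)"
    by transfer (auto simp: image_Un image_image shift_shift ac_simps)
  show "0 + a = a"
  proof transfer
    fix a :: "nat \<times> vertex set set"
    have "shift 0 v = v" for v by (cases v) auto
    then show "(case (0, {}) of (k, P) \<Rightarrow> \<lambda>(l, Q). (k + l, P \<union> (`) (shift k) ` Q)) a = a"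
      by (cases a) simp
  qed
  show "a + 0 = a" by transfer auto
qed

end

definition tensor_irreducible :: "diagram \<Rightarrow> bool" where
  "tensor_irreducible \<pi> \<longleftrightarrow> \<not> (\<exists>\<rho>1 \<rho>2. \<rho>1 \<noteq> 0 \<and> \<rho>2 \<noteq> 0 \<and> \<pi> = \<rho>1 + \<rho>2)"

definition merge :: "'a \<Rightarrow> 'a \<Rightarrow> 'a set set \<Rightarrow> 'a set set" where
  "merge x y P = insert (\<Union>{B \<in> P. x \<in> B \<or> y \<in> B}) {B \<in> P. x \<notin> B \<and> y \<notin> B}"

lemma partition_on_merge:
  assumes "partition_on A P" "x \<in> A"
  shows "partition_on A (merge x y P)"
proof -
  have 1: "\<Union>P = A" "\<And>p q. p \<in> P \<Longrightarrow> q \<in> P \<Longrightarrow> p \<noteq> q \<Longrightarrow> p \<inter> q = {}" "{} \<notin> P"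
    using assms by (auto simp: partition_on_def pairwise_def disjnt_def)
  obtain B where B: "B \<in> P" "x \<in> B" using assms 1 by blast
  show ?thesis
  proof (rule partition_onI)
    show "\<Union>(merge x y P) = A" using 1(1) unfolding merge_def by blast
    show "{} \<notin> merge x y P" using 1(3) B unfolding merge_def by blast
    fix p q assume "p \<in> merge x y P" "q \<in> merge x y P" "p \<noteq> q"
    then show "disjnt p q" using 1(2) unfolding merge_def disjnt_def by blast
  qed
qed

lemma partition_on_bullet:
  assumes "partition_on (vertices k) P" "partition_on (vertices l) Q" "k > 0"
  shows "partition_on (vertices (k + l))
    (merge (Bot k) (Bot (Suc k)) (P \<union> (`) (shift k) ` Q))"
proof (intro partition_on_merge partition_on_tensor assms)
  show "Bot k \<in> vertices (k + l)" using assms(3) by (auto simp: vertices_def)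
qed

lift_definition bullet :: "diagram \<Rightarrow> diagram \<Rightarrow> diagram" (infixr \<open>\<bullet>\<close> 70) is
  "\<lambda>(k, P) (l, Q).
     if k = 0 then (l, Q) else if l = 0 then (k, P)
     else (k + l, merge (Bot k) (Bot (k + 1)) (P \<union> (`) (shift k) ` Q))"
  by (auto simp: partition_on_bullet split: if_splits)

definition partial_permutation :: "diagram \<Rightarrow> bool" where
  "partial_permutation \<pi> \<longleftrightarrow>
     (\<forall>B\<in>blocks \<pi>. card B \<in> {1, 2} \<and> (card B = 2 \<longrightarrow> (\<exists>i j. B = {Top i, Bot j})))"

lemma order_zero [simp]: "order 0 = 0" by transfer simp
lemma order_add [simp]: "order (a + b) = order a + order b" by transfer auto
lemma blocks_add: "blocks (a + b) = blocks a \<union> (`) (shift (order a)) ` blocks b"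
  by transfer auto

lemma order_eq_0_iff: "order d = 0 \<longleftrightarrow> d = 0"
  by transfer (auto simp: vertices_def partition_on_empty)

lemma zero_bullet [simp]: "0 \<bullet> d = d" by transfer auto
lemma bullet_zero [simp]: "d \<bullet> 0 = d"
  by transfer (auto simp: vertices_def partition_on_empty)
lemma order_bullet [simp]: "order (a \<bullet> b) = order a + order b" by transfer auto

lemma blocks_bullet:
  "a \<noteq> 0 \<Longrightarrow> b \<noteq> 0 \<Longrightarrow>
   blocks (a \<bullet> b) = merge (Bot (order a)) (Bot (order a + 1)) (blocks (a + b))"
  unfolding order_eq_0_iff[symmetric] by transfer (auto split: prod.splits)

text \<open>Associativity of \<open>\<bullet>\<close>, so that products of several factors need no brackets.\<close>

lemma merge_merge:
  "merge x y (merge u v P) =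
    (if \<exists>B\<in>P. (x \<in> B \<or> y \<in> B) \<and> (u \<in> B \<or> v \<in> B)
     then insert (\<Union>{B \<in> P. x \<in> B \<or> y \<in> B \<or> u \<in> B \<or> v \<in> B})
       {B \<in> P. x \<notin> B \<and> y \<notin> B \<and> u \<notin> B \<and> v \<notin> B}
     else insert (\<Union>{B \<in> P. x \<in> B \<or> y \<in> B}) (insert (\<Union>{B \<in> P. u \<in> B \<or> v \<in> B})
       {B \<in> P. x \<notin> B \<and> y \<notin> B \<and> u \<notin> B \<and> v \<notin> B}))"
proof -
  let ?W = "\<Union>{B \<in> P. u \<in> B \<or> v \<in> B}"
  let ?R = "{B \<in> P. u \<notin> B \<and> v \<notin> B}"
  have m: "merge x y (insert ?W ?R) =
    insert (\<Union>{B \<in> insert ?W ?R. x \<in> B \<or> y \<in> B}) {B \<in> insert ?W ?R. x \<notin> B \<and> y \<notin> B}"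
    by (simp add: merge_def)
  show ?thesis
  proof (cases "x \<in> ?W \<or> y \<in> ?W")
    case True
    then have e: "{B \<in> insert ?W ?R. x \<in> B \<or> y \<in> B} = insert ?W {B \<in> ?R. x \<in> B \<or> y \<in> B}"
      "{B \<in> insert ?W ?R. x \<notin> B \<and> y \<notin> B} = {B \<in> ?R. x \<notin> B \<and> y \<notin> B}" by auto
    have e': "\<Union>(insert ?W {B \<in> ?R. x \<in> B \<or> y \<in> B}) =
      \<Union>{B \<in> P. x \<in> B \<or> y \<in> B \<or> u \<in> B \<or> v \<in> B}" by blast
    have e'': "{B \<in> ?R. x \<notin> B \<and> y \<notin> B} = {B \<in> P. x \<notin> B \<and> y \<notin> B \<and> u \<notin> B \<and> v \<notin> B}"
      by blast
    have ex: "\<exists>B\<in>P. (x \<in> B \<or> y \<in> B) \<and> (u \<in> B \<or> v \<in> B)" using True by blast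
    show ?thesis
      unfolding merge_def[of u v P] m if_P[OF ex] e e' e'' ..
  next
    case False
    then have e: "{B \<in> insert ?W ?R. x \<in> B \<or> y \<in> B} = {B \<in> P. x \<in> B \<or> y \<in> B}"
      "{B \<in> insert ?W ?R. x \<notin> B \<and> y \<notin> B} =
         insert ?W {B \<in> P. x \<notin> B \<and> y \<notin> B \<and> u \<notin> B \<and> v \<notin> B}" by blast+
    have nex: "\<not> (\<exists>B\<in>P. (x \<in> B \<or> y \<in> B) \<and> (u \<in> B \<or> v \<in> B))" using False by blast
    show ?thesis
      unfolding merge_def[of u v P] m if_not_P[OF nex] e ..
  qed
qed

lemma merge_commute: "merge x y (merge u v P) = merge u v (merge x y P)"
proof (cases "\<exists>B\<in>P. (x \<in> B \<or> y \<in> B) \<and> (u \<in> B \<or> v \<in> B)")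
  case True
  then have ex: "\<exists>B\<in>P. (u \<in> B \<or> v \<in> B) \<and> (x \<in> B \<or> y \<in> B)" by blast
  show ?thesis
    unfolding merge_merge if_P[OF True] if_P[OF ex] by (simp only: conj_ac disj_ac)
next
  case False
  then have nex: "\<not> (\<exists>B\<in>P. (u \<in> B \<or> v \<in> B) \<and> (x \<in> B \<or> y \<in> B))" by blast
  show ?thesis
    unfolding merge_merge if_not_P[OF False] if_not_P[OF nex]
    by (simp only: conj_ac insert_commute)
qed

lemma merge_Un_right: "x \<notin> \<Union>P \<Longrightarrow> y \<notin> \<Union>P \<Longrightarrow> merge x y (P \<union> Q) = P \<union> merge x y Q"
  unfolding merge_def by (intro equalityI subsetI) auto

lemma merge_Un_left: "x \<notin> \<Union>Q \<Longrightarrow> y \<notin> \<Union>Q \<Longrightarrow> merge x y (P \<union> Q) = merge x y P \<union> Q"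
  using merge_Un_right[of x Q y P] by (simp add: Un_commute)

lemma merge_image:
  assumes "inj f"
  shows "merge (f x) (f y) ((`) f ` P) = (`) f ` merge x y P"
proof -
  have f: "f z \<in> f ` B \<longleftrightarrow> z \<in> B" for z B using assms by (auto dest: injD)
  have "{B \<in> (`) f ` P. f x \<in> B \<or> f y \<in> B} = (`) f ` {B \<in> P. x \<in> B \<or> y \<in> B}"
    "{B \<in> (`) f ` P. f x \<notin> B \<and> f y \<notin> B} = (`) f ` {B \<in> P. x \<notin> B \<and> y \<notin> B}"
    using f by auto
  then show ?thesis by (simp add: merge_def image_Union)
qed

lemma bullet_assoc: "(a \<bullet> b) \<bullet> c = a \<bullet> (b \<bullet> c)"
proof (cases "a = 0 \<or> b = 0 \<or> c = 0")
  case False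
  then have nz: "a \<noteq> 0" "b \<noteq> 0" "c \<noteq> 0" and pos: "order a > 0" "order b > 0" "order c > 0"
    using order_eq_0_iff by auto
  then have nz': "a \<bullet> b \<noteq> 0" "b \<bullet> c \<noteq> 0" by (auto simp flip: order_eq_0_iff)
  let ?p = "order a" and ?q = "order b"
  let ?A = "blocks a" and ?B = "(`) (shift ?p) ` blocks b"
    and ?C = "(`) (shift (?p + ?q)) ` blocks c"
  have sub: "\<Union>(blocks d) = vertices (order d)" for d
    using partition_on_blocks[of d] by (simp add: partition_on_def)
  have A: "Bot (?p + ?q) \<notin> \<Union>?A" "Bot (?p + ?q + 1) \<notin> \<Union>?A"
    unfolding sub using pos by (auto simp: vertices_def)
  have "\<Union>?C = shift (?p + ?q) ` vertices (order c)" by (simp flip: image_Union sub)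
  then have C: "Bot ?p \<notin> \<Union>?C" "Bot (?p + 1) \<notin> \<Union>?C"
    using pos by (auto simp: vertices_def)
  have s: "shift ?p (Bot ?q) = Bot (?p + ?q)" "shift ?p (Bot (?q + 1)) = Bot (?p + ?q + 1)"
    by auto
  show ?thesis
  proof (rule diagram_eqI)
    have "blocks ((a \<bullet> b) \<bullet> c) =
        merge (Bot (?p + ?q)) (Bot (?p + ?q + 1)) (merge (Bot ?p) (Bot (?p + 1)) (?A \<union> ?B) \<union> ?C)"
      by (simp only: blocks_bullet[OF nz'(1) nz(3)] blocks_bullet[OF nz(1,2)] blocks_add order_bullet)
    also have "\<dots> = merge (Bot (?p + ?q)) (Bot (?p + ?q + 1))
        (merge (Bot ?p) (Bot (?p + 1)) (?A \<union> (?B \<union> ?C)))"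
      using merge_Un_left[OF C, of "?A \<union> ?B"] by (simp only: Un_assoc)
    also have "\<dots> = merge (Bot ?p) (Bot (?p + 1))
        (?A \<union> merge (Bot (?p + ?q)) (Bot (?p + ?q + 1)) (?B \<union> ?C))"
      by (subst merge_commute) (simp only: merge_Un_right[OF A])
    also have "?C = (`) (shift ?p) ` (`) (shift ?q) ` blocks c"
      by (simp add: image_image shift_shift add.commute)
    also have "merge (Bot (?p + ?q)) (Bot (?p + ?q + 1)) (?B \<union> \<dots>) =
        (`) (shift ?p) ` merge (Bot ?q) (Bot (?q + 1)) (blocks b \<union> (`) (shift ?q) ` blocks c)"
      unfolding s[symmetric] image_Un[symmetric] by (rule merge_image[OF inj_shift])
    also have "merge (Bot ?p) (Bot (?p + 1)) (?A \<union> \<dots>) = blocks (a \<bullet> (b \<bullet> c))"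
      by (simp only: blocks_bullet[OF nz(1) nz'(2)] blocks_bullet[OF nz(2,3)] blocks_add)
    finally show "blocks ((a \<bullet> b) \<bullet> c) = blocks (a \<bullet> (b \<bullet> c))" .
  qed simp
qed auto

section \<open>Vector spaces with a given basis\<close>

definition pm_scale :: "'k::field \<Rightarrow> ('b \<Rightarrow>\<^sub>0 'k) \<Rightarrow> ('b \<Rightarrow>\<^sub>0 'k)" where
  "pm_scale c = Poly_Mapping.map ((*) c)"

lemma lookup_pm_scale [simp]:
  "Poly_Mapping.lookup (pm_scale c x) b = c * Poly_Mapping.lookup x b"
  by (simp add: pm_scale_def map.rep_eq when_def)

global_interpretation pm: vector_space pm_scale
  by unfold_locales (auto intro!: poly_mapping_eqI simp: lookup_add algebra_simps)

type_synonym 'k parsym = "diagram \<Rightarrow>\<^sub>0 'k"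

text \<open>The tensor product of the spaces with bases \<open>'a\<close> and \<open>'b\<close> is the space with basis
  \<open>'a \<times> 'b\<close>; its product is the monoid algebra product for the componentwise
  addition on pairs, which is the tensor product algebra structure (see \<open>tensor_mult\<close>).\<close>

type_synonym 'k parsym2 = "diagram \<times> diagram \<Rightarrow>\<^sub>0 'k"

definition H :: "diagram \<Rightarrow> 'k::field parsym" where
  "H \<pi> = Poly_Mapping.single \<pi> 1"

definition tensor :: "('a \<Rightarrow>\<^sub>0 'k::field) \<Rightarrow> ('b \<Rightarrow>\<^sub>0 'k) \<Rightarrow> ('a \<times> 'b \<Rightarrow>\<^sub>0 'k)" where
  "tensor x y = (\<Sum>a\<in>Poly_Mapping.keys x. \<Sum>b\<in>Poly_Mapping.keys y.
     Poly_Mapping.single (a, b) (Poly_Mapping.lookup x a * Poly_Mapping.lookup y b))"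

lemma H_mult: "H \<pi> * H \<rho> = H (\<pi> + \<rho>)" by (simp add: H_def mult_single)
lemma H_zero: "H 0 = 1" by (simp add: H_def)

lemma lookup_tensor:
  "Poly_Mapping.lookup (tensor x y) (a, b) = Poly_Mapping.lookup x a * Poly_Mapping.lookup y b"
proof -
  have "Poly_Mapping.lookup (tensor x y) (a, b) =
      (\<Sum>a'\<in>Poly_Mapping.keys x. if a' = a then
        (\<Sum>b'\<in>Poly_Mapping.keys y. if b' = b then Poly_Mapping.lookup x a * Poly_Mapping.lookup y b else 0) else 0)"
    unfolding tensor_def lookup_sum
    by (intro sum.cong refl) (auto simp: lookup_single when_def intro!: sum.cong sum.neutral)
  also have "\<dots> = Poly_Mapping.lookup x a * Poly_Mapping.lookup y b"
    by (auto simp: sum.delta in_keys_iff)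
  finally show ?thesis .
qed

lemma tensor_add_left: "tensor (x + x') y = tensor x y + tensor x' y"
  by (rule poly_mapping_eqI) (auto simp: lookup_tensor lookup_add algebra_simps split_paired_all)
lemma tensor_add_right: "tensor x (y + y') = tensor x y + tensor x y'"
  by (rule poly_mapping_eqI) (auto simp: lookup_tensor lookup_add algebra_simps split_paired_all)
lemma tensor_single:
  "tensor (Poly_Mapping.single a c) (Poly_Mapping.single b d) = Poly_Mapping.single (a, b) (c * d)"
  by (rule poly_mapping_eqI) (auto simp: lookup_tensor lookup_single when_def split_paired_all)
lemma tensor_zero [simp]: "tensor 0 y = 0" "tensor x 0 = 0"
  by (auto simp: tensor_def)
lemma tensor_H: "tensor (H a) (H b) = Poly_Mapping.single (a, b) 1"
  by (simp add: H_def tensor_single)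

lemma pm_induct [case_names zero single add]:
  assumes "P 0" "\<And>a c. P (Poly_Mapping.single a c)" "\<And>x y. P x \<Longrightarrow> P y \<Longrightarrow> P (x + y)"
  shows "P (x :: 'b \<Rightarrow>\<^sub>0 'k::comm_monoid_add)"
proof -
  have "x = (\<Sum>d\<in>Poly_Mapping.keys x. Poly_Mapping.single d (Poly_Mapping.lookup x d))"
    by (rule poly_mapping_eqI)
      (auto simp: lookup_sum lookup_single when_def sum.delta in_keys_iff)
  moreover have "P (\<Sum>d\<in>A. Poly_Mapping.single d (Poly_Mapping.lookup x d))" for A
    using assms by (induction A rule: infinite_finite_induct) auto
  ultimately show ?thesis by metis
qed

lemma tensor_mult:
  fixes x x' :: "'a::monoid_add \<Rightarrow>\<^sub>0 'k::field" and y y' :: "'b::monoid_add \<Rightarrow>\<^sub>0 'k"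
  shows "tensor x y * tensor x' y' = tensor (x * x') (y * y')"
proof (induction x rule: pm_induct)
  case (single a c) show ?case
  proof (induction y rule: pm_induct)
    case (single b d) show ?case
    proof (induction x' rule: pm_induct)
      case (single a' c') show ?case
      proof (induction y' rule: pm_induct)
        case (single b' d') show ?case by (simp add: tensor_single mult_single algebra_simps)
      qed (simp_all add: tensor_add_right distrib_left)
    qed (simp_all add: tensor_add_left distrib_left)
  qed (simp_all add: tensor_add_right distrib_left distrib_right)
qed (simp_all add: tensor_add_left distrib_left distrib_right)

section \<open>Coproduct and antipode\<close>

definition is_coproduct :: "('k::field parsym \<Rightarrow> 'k parsym2) \<Rightarrow> bool" where
  "is_coproduct D \<longleftrightarrow>
     Vector_Spaces.linear pm_scale pm_scale D \<and>
     (\<forall>x y. D (x * y) = D x * D y) \<and>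
     D (H 0) = tensor (H 0) (H 0) \<and>
     (\<forall>\<pi>. \<pi> \<noteq> 0 \<longrightarrow> tensor_irreducible \<pi> \<longrightarrow>
        D (H \<pi>) =
          (\<Sum>(G1, G2) \<in> {(G1, G2). (G1 = 0 \<or> tensor_irreducible G1) \<and>
             (G2 = 0 \<or> tensor_irreducible G2) \<and> G1 \<bullet> G2 = \<pi>}. tensor (H G1) (H G2)))"

definition coproduct :: "'k::field parsym \<Rightarrow> 'k parsym2" where
  "coproduct = (THE D. is_coproduct D)"

text \<open>Tuples are lists; as \<open>\<bullet>\<close> is associative with unit \<open>0\<close>,
  \<open>foldr (\<bullet>) [\<rho>1, \<dots>, \<rho>l] 0\<close> is $\rho^{(1)}\bullet\cdots\bullet\rho^{(l)}$.
  The empty list yields \<open>0\<close> and hence never contributes below.\<close>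

definition is_antipode :: "('k::field parsym \<Rightarrow> 'k parsym) \<Rightarrow> bool" where
  "is_antipode S \<longleftrightarrow>
     Vector_Spaces.linear pm_scale pm_scale S \<and>
     (\<forall>x y. S (x * y) = S y * S x) \<and>
     S (H 0) = H 0 \<and>
     (\<forall>\<pi>. \<pi> \<noteq> 0 \<longrightarrow> tensor_irreducible \<pi> \<longrightarrow>
        S (H \<pi>) =
          (\<Sum>\<rho>s \<in> {\<rho>s. 0 \<notin> set \<rho>s \<and> foldr (\<bullet>) \<rho>s 0 = \<pi>}.
             pm_scale ((-1) ^ length \<rho>s) (prod_list (map H \<rho>s))))"

definition antipode :: "'k::field parsym \<Rightarrow> 'k parsym" where
  "antipode = (THE S. is_antipode S)"

definition tensor_square :: "'k::field parsym set \<Rightarrow> 'k parsym2 set" where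
  "tensor_square W = pm.span {tensor x y | x y. x \<in> W \<and> y \<in> W}"

definition hopf_subalgebra :: "'k::field parsym set \<Rightarrow> bool" where
  "hopf_subalgebra W \<longleftrightarrow>
     pm.subspace W \<and>
     H 0 \<in> W \<and>
     (\<forall>x\<in>W. \<forall>y\<in>W. x * y \<in> W) \<and>
     (\<forall>x\<in>W. coproduct x \<in> tensor_square W) \<and>
     (\<forall>x\<in>W. antipode x \<in> W)"

section \<open>Well-definedness of the coproduct and the antipode\<close>

text \<open>The index sets of the defining sums are finite.\<close>

lemma finite_vertices: "finite (vertices k)" by (simp add: vertices_def)

lemma finite_diagrams: "finite {d. order d \<le> n}"
proof (rule finite_imageD)
  show "inj_on (\<lambda>d. (order d, blocks d)) {d. order d \<le> n}"
    by (auto intro!: inj_onI diagram_eqI)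
  have "blocks d \<subseteq> Pow (vertices n)" if "order d \<le> n" for d
  proof -
    have "\<Union>(blocks d) = vertices (order d)"
      using partition_on_blocks[of d] by (simp add: partition_on_def)
    moreover have "vertices (order d) \<subseteq> vertices n" using that by (auto simp: vertices_def)
    ultimately show ?thesis by blast
  qed
  then have "(\<lambda>d. (order d, blocks d)) ` {d. order d \<le> n} \<subseteq> {..n} \<times> Pow (Pow (vertices n))"
    by blast
  then show "finite ((\<lambda>d. (order d, blocks d)) ` {d. order d \<le> n})"
    by (rule finite_subset) (simp add: finite_vertices)
qed

lemma finite_bullet_pairs: "finite {(G1, G2). P G1 \<and> Q G2 \<and> G1 \<bullet> G2 = \<pi>}"
  by (rule finite_subset[of _ "{d. order d \<le> order \<pi>} \<times> {d. order d \<le> order \<pi>}"])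
    (auto simp: finite_diagrams)

lemma order_foldr_bullet: "order (foldr (\<bullet>) \<rho>s 0) = (\<Sum>\<rho>\<leftarrow>\<rho>s. order \<rho>)"
  by (induction \<rho>s) auto

lemma finite_bullet_tuples: "finite {\<rho>s. 0 \<notin> set \<rho>s \<and> foldr (\<bullet>) \<rho>s 0 = \<pi>}"
proof (rule finite_subset)
  have "length \<rho>s \<le> (\<Sum>\<rho>\<leftarrow>\<rho>s. order \<rho>)" if "0 \<notin> set \<rho>s" for \<rho>s
    using that
  proof (induction \<rho>s)
    case (Cons a \<rho>s)
    then have "order a \<ge> 1" using order_eq_0_iff[of a] by (cases "order a") auto
    with Cons show ?case by simp
  qed simp
  moreover have "\<rho> \<in> set \<rho>s \<Longrightarrow> order \<rho> \<le> (\<Sum>\<rho>\<leftarrow>\<rho>s. order \<rho>)" for \<rho> \<rho>s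
    by (rule member_le_sum_list) auto
  ultimately show "{\<rho>s. 0 \<notin> set \<rho>s \<and> foldr (\<bullet>) \<rho>s 0 = \<pi>} \<subseteq>
      {\<rho>s. set \<rho>s \<subseteq> {d. order d \<le> order \<pi>} \<and> length \<rho>s \<le> order \<pi>}"
    by (auto simp flip: order_foldr_bullet)
  show "finite {\<rho>s. set \<rho>s \<subseteq> {d. order d \<le> order \<pi>} \<and> length \<rho>s \<le> order \<pi>}"
    by (intro finite_lists_length_le finite_diagrams)
qed

text \<open>Unique factorization into nonempty irreducible diagrams.\<close>

lemma blocks_subset: "B \<in> blocks d \<Longrightarrow> B \<subseteq> vertices (order d)"
  using partition_on_blocks[of d] by (auto simp: partition_on_def)

lemma blocks_nonempty: "B \<in> blocks d \<Longrightarrow> B \<noteq> {}"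
  using partition_on_blocks[of d] by (auto simp: partition_on_def)

lemma shifted_block: "B \<in> blocks d \<Longrightarrow> \<not> shift k ` B \<subseteq> vertices k"
  using blocks_subset[of B d] blocks_nonempty[of B d] shift_vertices_disjoint by blast

lemma blocks_left: "blocks a = {B \<in> blocks (a + b). B \<subseteq> vertices (order a)}"
  using shifted_block[of _ b "order a"] blocks_subset[of _ a] by (auto simp: blocks_add)

lemma shift_in_blocks_iff:
  assumes "B \<subseteq> vertices m"
  shows "shift (order a) ` B \<in> blocks (a + b) \<longleftrightarrow> B \<in> blocks b"
proof
  assume *: "shift (order a) ` B \<in> blocks (a + b)"
  then have "B \<noteq> {}" using blocks_nonempty by fastforce
  then have "shift (order a) ` B \<notin> blocks a"
    using blocks_subset[of "shift (order a) ` B" a] assms shift_vertices_disjoint by blast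
  with * show "B \<in> blocks b" by (auto simp: blocks_add inj_image_eq_iff[OF inj_shift])
qed (auto simp: blocks_add)

lemma diagram_add_left_cancel:
  fixes a b b' :: diagram
  assumes eq: "a + b = a + b'"
  shows "b = b'"
proof (rule diagram_eqI)
  show "order b = order b'" using arg_cong[OF eq, of order] by simp
  show "blocks b = blocks b'"
    using shift_in_blocks_iff[of _ _ a b] shift_in_blocks_iff[of _ _ a b'] eq
      blocks_subset[of _ b] blocks_subset[of _ b'] by (metis subsetI subset_antisym)
qed

lemma diagram_add_equidivisible:
  assumes eq: "a + b = c + d" and le: "order a \<le> order c"
  obtains e where "c = a + e" "b = e + d"
proof -
  define p m where "p = order a" and "m = order c - order a"
  have c: "order c = p + m" using le by (simp add: p_def m_def)
  define E where "E = {B \<in> blocks b. shift p ` B \<in> blocks c}"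
  have part: "partition_on (vertices m) E"
  proof (rule partition_onI)
    show "{} \<notin> E" using blocks_nonempty by (auto simp: E_def)
    show "disjnt B B'" if "B \<in> E" "B' \<in> E" "B \<noteq> B'" for B B'
      using that partition_on_blocks[of b] by (auto simp: E_def partition_on_def pairwise_def)
    show "\<Union>E = vertices m"
    proof (intro equalityI subsetI)
      fix v assume "v \<in> \<Union>E"
      then obtain B where B: "v \<in> B" "B \<in> blocks b" "shift p ` B \<in> blocks c"
        by (auto simp: E_def)
      then have "v \<in> vertices (order b)" "shift p v \<in> vertices (p + m)"
        using blocks_subset c by (blast, metis blocks_subset c image_subset_iff)
      then show "v \<in> vertices m" by (simp add: shift_in_vertices_iff)
    next
      fix v assume v: "v \<in> vertices m"
      then have "shift p v \<in> vertices (order c)" unfolding c vertices_add by blast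
      then obtain B where B: "B \<in> blocks c" "shift p v \<in> B"
        using partition_on_blocks[of c] by (auto simp: partition_on_def)
      have "B \<in> blocks (a + b)" using B unfolding eq by (auto simp: blocks_add)
      moreover have "shift p v \<notin> vertices (order a)"
        using shift_vertices_disjoint[OF v] by (simp add: p_def)
      then have "B \<notin> blocks a" using B blocks_subset by blast
      ultimately obtain B' where B': "B' \<in> blocks b" "B = shift p ` B'"
        by (auto simp: blocks_add p_def)
      with B have "v \<in> B'" by (auto dest: injD[OF inj_shift])
      with B B' show "v \<in> \<Union>E" by (auto simp: E_def)
    qed
  qed
  define e where "e = Abs_diagram (m, E)"
  have e: "order e = m" "blocks e = E"
    using part by (simp_all add: e_def order.rep_eq blocks.rep_eq Abs_diagram_inverse)
  have "c = a + e"
  proof (rule diagram_eqI)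
    show "order c = order (a + e)" by (simp add: c e p_def)
    have "blocks a \<subseteq> blocks c"
    proof
      fix B assume B: "B \<in> blocks a"
      then have "B \<in> blocks (c + d)" unfolding eq[symmetric] by (simp add: blocks_add)
      moreover have "B \<subseteq> vertices (order c)"
        using blocks_subset[OF B] unfolding c p_def vertices_add by blast
      ultimately show "B \<in> blocks c" using blocks_left[of c d] by simp
    qed
    moreover have "B \<in> blocks a \<or> B \<in> (`) (shift p) ` E" if "B \<in> blocks c" for B
    proof -
      have "B \<in> blocks (a + b)" unfolding eq using that by (simp add: blocks_add)
      with that show ?thesis by (auto simp: blocks_add E_def p_def)
    qed
    ultimately show "blocks c = blocks (a + e)"
      by (auto simp: blocks_add e p_def E_def)
  qed
  moreover from this have "b = e + d"
    using eq by (auto simp: add.assoc intro: diagram_add_left_cancel)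
  ultimately show ?thesis using that by blast
qed

definition irreducibles :: "diagram set" where
  "irreducibles = {\<pi>. \<pi> \<noteq> 0 \<and> tensor_irreducible \<pi>}"

lemma factorization_unique:
  "set xs \<subseteq> irreducibles \<Longrightarrow> set ys \<subseteq> irreducibles \<Longrightarrow> sum_list xs = sum_list ys \<Longrightarrow> xs = ys"
proof (induction xs arbitrary: ys)
  have nz: "sum_list (x # xs) \<noteq> 0" if "x \<in> irreducibles" for x xs
    using that by (auto simp: irreducibles_def simp flip: order_eq_0_iff)
  {
    case Nil
    then show ?case using nz by (cases ys) (auto simp del: sum_list.Cons)
  next
    case (Cons x xs)
    then obtain y ys' where ys: "ys = y # ys'" using nz[of x xs] by (cases ys) auto
    have x: "x \<in> irreducibles" and y: "y \<in> irreducibles" using Cons.prems ys by auto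
    have eq: "x + sum_list xs = y + sum_list ys'" using Cons.prems ys by simp
    have aux: "u = v" if uv: "u + U = v + V" "order u \<le> order v" and irr: "u \<in> irreducibles" "v \<in> irreducibles"
      for u v U V
    proof -
      obtain e where "v = u + e" by (rule diagram_add_equidivisible[OF uv])
      moreover from this irr have "e = 0"
        unfolding irreducibles_def tensor_irreducible_def by blast
      ultimately show "u = v" by simp
    qed
    have "x = y"
    proof (cases "order x \<le> order y")
      case True then show ?thesis using aux[OF eq] x y by blast
    next
      case False then show ?thesis using aux[OF eq[symmetric]] x y by simp
    qed
    moreover have "sum_list xs = sum_list ys'"
      using eq diagram_add_left_cancel unfolding \<open>x = y\<close> by blast
    ultimately show ?case using Cons ys by auto
  }
qed

lemma factorization_exists: "\<exists>xs. set xs \<subseteq> irreducibles \<and> sum_list xs = d"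
proof (induction "order d" arbitrary: d rule: less_induct)
  case less
  consider "d = 0" | "d \<in> irreducibles" | a b where "a \<noteq> 0" "b \<noteq> 0" "d = a + b"
    by (auto simp: irreducibles_def tensor_irreducible_def)
  then show ?case
  proof cases
    case 1 then show ?thesis by (intro exI[of _ "[]"]) simp
  next
    case 2 then show ?thesis by (intro exI[of _ "[d]"]) simp
  next
    case 3
    then have "order a < order d" "order b < order d"
      using order_eq_0_iff[of a] order_eq_0_iff[of b] by auto
    then obtain xs ys where "set xs \<subseteq> irreducibles" "sum_list xs = a"
      "set ys \<subseteq> irreducibles" "sum_list ys = b" using less by meson
    with 3 show ?thesis by (intro exI[of _ "xs @ ys"]) simp
  qed
qed

definition factors :: "diagram \<Rightarrow> diagram list" where
  "factors d = (THE xs. set xs \<subseteq> irreducibles \<and> sum_list xs = d)"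

lemma factors_eqI: "set xs \<subseteq> irreducibles \<Longrightarrow> sum_list xs = d \<Longrightarrow> factors d = xs"
  unfolding factors_def using factorization_unique by (intro the_equality) blast+

lemma factors: "set (factors d) \<subseteq> irreducibles" "sum_list (factors d) = d"
  using factorization_exists[of d] factors_eqI by metis+

lemma factors_add: "factors (a + b) = factors a @ factors b"
  using factors by (intro factors_eqI) auto

lemma factors_zero: "factors 0 = []" by (intro factors_eqI) auto

lemma factors_irreducible: "d \<in> irreducibles \<Longrightarrow> factors d = [d]"
  by (intro factors_eqI) auto

text \<open>Linear extension, and the resulting (anti)morphisms out of the free algebra.\<close>

definition lin_ext :: "('a \<Rightarrow> 'b \<Rightarrow>\<^sub>0 'k::field) \<Rightarrow> ('a \<Rightarrow>\<^sub>0 'k) \<Rightarrow> ('b \<Rightarrow>\<^sub>0 'k)" where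
  "lin_ext g x = (\<Sum>d\<in>Poly_Mapping.keys x. pm_scale (Poly_Mapping.lookup x d) (g d))"

lemma lin_ext_superset:
  assumes "finite A" "Poly_Mapping.keys x \<subseteq> A"
  shows "lin_ext g x = (\<Sum>d\<in>A. pm_scale (Poly_Mapping.lookup x d) (g d))"
  unfolding lin_ext_def using assms
  by (intro sum.mono_neutral_left) (auto simp: in_keys_iff)

lemma linear_lin_ext: "Vector_Spaces.linear pm_scale pm_scale (lin_ext g)"
proof (unfold_locales, goal_cases)
  case (1 x y)
  let ?A = "Poly_Mapping.keys x \<union> Poly_Mapping.keys y"
  have "Poly_Mapping.keys (x + y) \<subseteq> ?A" by (rule Poly_Mapping.keys_add)
  then show ?case
    by (simp add: lin_ext_superset[of ?A] lookup_add pm.scale_left_distrib sum.distrib)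
next
  case (2 c x)
  have "Poly_Mapping.keys (pm_scale c x) \<subseteq> Poly_Mapping.keys x" by (auto simp: in_keys_iff)
  then show ?case
    by (simp add: lin_ext_superset[of "Poly_Mapping.keys x"] pm.scale_sum_right)
qed

lemma lin_ext_H: "lin_ext g (H d) = g d"
  by (simp add: lin_ext_def H_def)

lemma single_eq_scale_H: "Poly_Mapping.single d c = pm_scale c (H d)"
  by (rule poly_mapping_eqI) (auto simp: H_def lookup_single when_def)

lemma pm_scale_conv_mult: "pm_scale c x = Poly_Mapping.single 0 c * x"
  by (simp add: pm_scale_def mult_map_scale_conv_mult)

lemma pm_scale_mult_left:
  fixes x y :: "'a::monoid_add \<Rightarrow>\<^sub>0 'k::field"
  shows "pm_scale c x * y = pm_scale c (x * y)"
  by (simp add: pm_scale_conv_mult mult.assoc)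

lemma pm_scale_mult_right:
  fixes x y :: "'a::monoid_add \<Rightarrow>\<^sub>0 'k::field"
  shows "x * pm_scale c y = pm_scale c (x * y)"
proof (induction x rule: pm_induct)
  case (single a d) show ?case
    by (simp add: pm_scale_conv_mult mult_single mult.commute flip: mult.assoc)
qed (simp_all add: distrib_right pm.scale_right_distrib)

lemma linear_H_eqI:
  assumes "Vector_Spaces.linear pm_scale pm_scale F" "Vector_Spaces.linear pm_scale pm_scale G"
    and "\<And>d. F (H d) = G (H d)"
  shows "F x = G x"
proof -
  interpret F: Vector_Spaces.linear pm_scale pm_scale F by fact
  interpret G: Vector_Spaces.linear pm_scale pm_scale G by fact
  show ?thesis
    by (induction x rule: pm_induct)
      (simp_all add: single_eq_scale_H F.zero G.zero F.add G.add F.scale G.scale assms)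
qed

lemma linear_mult_H:
  fixes F :: "'k::field parsym \<Rightarrow> ('b::monoid_add \<Rightarrow>\<^sub>0 'k)"
  assumes "Vector_Spaces.linear pm_scale pm_scale F"
    and "\<And>a b. F (H (a + b)) = F (H a) * F (H b)"
  shows "F (x * y) = F x * F y"
proof -
  interpret F: Vector_Spaces.linear pm_scale pm_scale F by fact
  show ?thesis
  proof (induction x rule: pm_induct)
    case (single a c) show ?case
      by (induction y rule: pm_induct)
        (auto simp: single_eq_scale_H F.zero F.add F.scale distrib_left
          pm_scale_mult_left pm_scale_mult_right H_mult assms pm.scale_right_distrib)
  qed (simp_all add: F.zero F.add distrib_right)
qed

lemma linear_antimult_H:
  fixes F :: "'k::field parsym \<Rightarrow> ('b::monoid_add \<Rightarrow>\<^sub>0 'k)"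
  assumes "Vector_Spaces.linear pm_scale pm_scale F"
    and "\<And>a b. F (H (a + b)) = F (H b) * F (H a)"
  shows "F (x * y) = F y * F x"
proof -
  interpret F: Vector_Spaces.linear pm_scale pm_scale F by fact
  show ?thesis
  proof (induction x rule: pm_induct)
    case (single a c) show ?case
      by (induction y rule: pm_induct)
        (auto simp: single_eq_scale_H F.zero F.add F.scale distrib_left distrib_right
          pm_scale_mult_left pm_scale_mult_right H_mult assms mult.commute pm.scale_right_distrib)
  qed (simp_all add: F.zero F.add distrib_left distrib_right)
qed

lemma morphism_ex1:
  fixes f :: "diagram \<Rightarrow> ('b::monoid_add \<Rightarrow>\<^sub>0 'k::field)"
  shows "\<exists>!F. Vector_Spaces.linear pm_scale pm_scale F \<and> (\<forall>x y. F (x * y) = F x * F y) \<and>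
    F (H 0) = 1 \<and> (\<forall>\<pi>. \<pi> \<noteq> 0 \<longrightarrow> tensor_irreducible \<pi> \<longrightarrow> F (H \<pi>) = f \<pi>)"
    (is "\<exists>!F. ?P F")
proof (rule ex_ex1I)
  let ?F = "lin_ext (\<lambda>d. prod_list (map f (factors d)))"
  have "?F (x * y) = ?F x * ?F y" for x y
    by (rule linear_mult_H[OF linear_lin_ext]) (simp add: lin_ext_H factors_add)
  then have "?P ?F"
    by (simp add: linear_lin_ext lin_ext_H factors_zero factors_irreducible irreducibles_def)
  then show "\<exists>F. ?P F" by blast
next
  fix F G assume F: "?P F" and G: "?P G"
  have "F (H (sum_list xs)) = G (H (sum_list xs))" if "set xs \<subseteq> irreducibles" for xs
    using that
  proof (induction xs)
    case (Cons x xs)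
    then show ?case using F G by (simp add: irreducibles_def flip: H_mult)
  qed (use F G in simp)
  then have "F (H d) = G (H d)" for d using factors[of d] by metis
  then show "F = G" using F G linear_H_eqI by blast
qed

lemma antimorphism_ex1:
  fixes f :: "diagram \<Rightarrow> ('b::monoid_add \<Rightarrow>\<^sub>0 'k::field)"
  shows "\<exists>!F. Vector_Spaces.linear pm_scale pm_scale F \<and> (\<forall>x y. F (x * y) = F y * F x) \<and>
    F (H 0) = 1 \<and> (\<forall>\<pi>. \<pi> \<noteq> 0 \<longrightarrow> tensor_irreducible \<pi> \<longrightarrow> F (H \<pi>) = f \<pi>)"
    (is "\<exists>!F. ?P F")
proof (rule ex_ex1I)
  let ?F = "lin_ext (\<lambda>d. prod_list (map f (rev (factors d))))"
  have "?F (x * y) = ?F y * ?F x" for x y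
    by (rule linear_antimult_H[OF linear_lin_ext]) (simp add: lin_ext_H factors_add)
  then have "?P ?F"
    by (simp add: linear_lin_ext lin_ext_H factors_zero factors_irreducible irreducibles_def)
  then show "\<exists>F. ?P F" by blast
next
  fix F G assume F: "?P F" and G: "?P G"
  have "F (H (sum_list xs)) = G (H (sum_list xs))" if "set xs \<subseteq> irreducibles" for xs
    using that
  proof (induction xs)
    case (Cons x xs)
    then show ?case using F G by (simp add: irreducibles_def flip: H_mult)
  qed (use F G in simp)
  then have "F (H d) = G (H d)" for d using factors[of d] by metis
  then show "F = G" using F G linear_H_eqI by blast
qed

theorem coproduct_ex1: "\<exists>!D. is_coproduct D"
  unfolding is_coproduct_def tensor_H[of 0 0] zero_prod_def[symmetric] single_one
  by (rule morphism_ex1)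

theorem antipode_ex1: "\<exists>!S. is_antipode S"
  unfolding is_antipode_def H_zero[symmetric, THEN eq_reflection] using antimorphism_ex1
  by (simp add: H_zero)

corollary is_coproduct_coproduct: "is_coproduct coproduct"
  unfolding coproduct_def by (rule theI'[OF coproduct_ex1])

corollary is_antipode_antipode: "is_antipode antipode"
  unfolding antipode_def by (rule theI'[OF antipode_ex1])

end

theory Submission
  imports Defs
begin

text \<open>A product \<open>\<pi> \<bullet> \<rho>\<close> of nonempty diagrams has a block containing both $k'$ and $(k+1)'$,
  which no block of a partial permutation does. Hence a partial permutation has only the
  trivial factorizations with respect to \<open>\<bullet>\<close>, whose factors are again partial permutations; in
  particular $\textsf{H}_\pi$ is primitive when $\pi$ is in addition $\otimes$-irreducible. As
  partial permutations form a submonoid closed under taking $\otimes$-factors, the claim for all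
  partial permutations follows from the (anti)multiplicativity of the coproduct and the antipode.\<close>

lemma partial_permutation_zero: "partial_permutation 0"
proof -
  have "blocks 0 = {}" by transfer simp
  then show ?thesis by (simp add: partial_permutation_def)
qed

text \<open>Shifting is injective and preserves the two rows, so the shape of a block can be
  recovered from its shifted copy.\<close>

lemma shift_image_eq_Top_Bot:
  "(\<exists>i j. shift k ` B = {Top i, Bot j}) \<longleftrightarrow> (\<exists>i j. B = {Top i, Bot j})"
proof
  assume "\<exists>i j. shift k ` B = {Top i, Bot j}"
  then obtain i j where B: "shift k ` B = {Top i, Bot j}" by blast
  then obtain u v where uv: "Top i = shift k u" "Bot j = shift k v" by blast
  then have "shift k ` B = shift k ` {u, v}" using B by simp
  then have "B = {u, v}" by (simp only: inj_image_eq_iff[OF inj_shift])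
  moreover obtain i' j' where "u = Top i'" "v = Bot j'" using uv by (cases u; cases v) auto
  ultimately show "\<exists>i j. B = {Top i, Bot j}" by blast
qed fastforce

text \<open>Shifting changes neither the size nor the shape of a block, so the condition can be
  checked on each factor separately.\<close>

lemma partial_permutation_add:
  "partial_permutation (a + b) \<longleftrightarrow> partial_permutation a \<and> partial_permutation b"
  by (simp add: partial_permutation_def blocks_add ball_Un shift_image_eq_Top_Bot
      card_image[OF inj_on_subset[OF inj_shift]])

lemma partial_permutation_bullet_trivial:
  assumes "partial_permutation (a \<bullet> b)"
  shows "a = 0 \<or> b = 0"
proof (rule ccontr)
  assume "\<not> (a = 0 \<or> b = 0)"
  then have nz: "a \<noteq> 0" "b \<noteq> 0" by auto
  then have pos: "order a > 0" "order b > 0" using order_eq_0_iff by auto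
  let ?x = "Bot (order a)" and ?y = "Bot (order a + 1)"
  \<comment> \<open>\<open>?M\<close> is the block created by \<open>merge\<close>.\<close>
  let ?M = "\<Union>{B \<in> blocks (a + b). ?x \<in> B \<or> ?y \<in> B}"
  have "?M \<in> blocks (a \<bullet> b)" using nz by (simp add: blocks_bullet merge_def)
  then have M: "card ?M \<in> {1, 2}" "card ?M = 2 \<longrightarrow> (\<exists>i j. ?M = {Top i, Bot j})"
    using assms unfolding partial_permutation_def by blast+
  have "?x \<in> \<Union>(blocks (a + b))" "?y \<in> \<Union>(blocks (a + b))"
    using partition_on_blocks[of "a + b"] pos by (auto simp: partition_on_def vertices_def)
  then have sub: "{?x, ?y} \<subseteq> ?M" by blast
  \<comment> \<open>An infinite set has \<open>card\<close> 0, which \<open>M(1)\<close>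
    excludes.\<close>
  have "finite ?M" using M(1) by (auto intro: card_ge_0_finite)
  then have "card {?x, ?y} \<le> card ?M" using sub by (rule card_mono)
  then have "card ?M = 2" using M(1) by auto
  then obtain i j where "?M = {Top i, Bot j}" using M(2) by blast
  \<comment> \<open>\<open>?x\<close> and \<open>?y\<close> are two distinct bottom vertices, but
    \<open>{Top i, Bot j}\<close> has room for only one.\<close>
  then show False using sub by auto
qed

lemma partial_permutation_bulletD:
  assumes "partial_permutation (a \<bullet> b)"
  shows "partial_permutation a" "partial_permutation b"
  using partial_permutation_bullet_trivial[OF assms] assms partial_permutation_zero by auto

lemma partial_permutation_foldr_bulletD:
  "partial_permutation (foldr (\<bullet>) \<rho>s 0) \<Longrightarrow> \<rho> \<in> set \<rho>s \<Longrightarrow> partial_permutation \<rho>"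
  by (induction \<rho>s) (auto dest: partial_permutation_bulletD)

text \<open>By bilinearity: a span induction on \<open>y\<close> with a generator on the left, then
  one on \<open>x\<close>. The monoid is left general to serve both the span itself and its tensor
  square.\<close>

lemma span_mult_closed:
  fixes A :: "('b::monoid_add \<Rightarrow>\<^sub>0 'k::field) set"
  assumes A: "\<And>a b. a \<in> A \<Longrightarrow> b \<in> A \<Longrightarrow> a * b \<in> pm.span A"
    and x: "x \<in> pm.span A" and y: "y \<in> pm.span A"
  shows "x * y \<in> pm.span A"
proof -
  have *: "a * y \<in> pm.span A" if "a \<in> A" for a
    using y
    by (induction rule: pm.span_induct_alt)
      (simp_all add: pm.span_zero distrib_left pm_scale_mult_right pm.span_add pm.span_scale A that)
  show ?thesis
    using x
    by (induction rule: pm.span_induct_alt)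
      (simp_all add: pm.span_zero distrib_right pm_scale_mult_left pm.span_add pm.span_scale *)
qed

text \<open>The generators are the pure tensors, and \<open>tensor_mult\<close> makes a product of
  two of them a pure tensor again.\<close>

lemma tensor_square_mult_closed:
  fixes W :: "'k::field parsym set"
  assumes W: "\<And>x y. x \<in> W \<Longrightarrow> y \<in> W \<Longrightarrow> x * y \<in> W"
    and "x \<in> tensor_square W" "y \<in> tensor_square W"
  shows "x * y \<in> tensor_square W"
  using assms(2,3) unfolding tensor_square_def
proof (rule span_mult_closed[rotated])
  fix a b
  assume "a \<in> {tensor x y | x y. x \<in> W \<and> y \<in> W}" "b \<in> {tensor x y | x y. x \<in> W \<and> y \<in> W}"
  then obtain u v u' v' where ab: "a = tensor u v" "b = tensor u' v'"
    and in_W: "u \<in> W" "v \<in> W" "u' \<in> W" "v' \<in> W"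
    by blast
  have "a * b = tensor (u * u') (v * v')" by (simp only: ab tensor_mult)
  then show "a * b \<in> pm.span {tensor x y | x y. x \<in> W \<and> y \<in> W}"
    using W[OF in_W(1,3)] W[OF in_W(2,4)] by (intro pm.span_base) blast
qed

text \<open>Reduces the claims on coproduct and antipode to the basis elements
  \<open>H \<pi>\<close>.\<close>

lemma linear_image_span_subset:
  assumes "Vector_Spaces.linear pm_scale pm_scale F" "pm.subspace V"
    and "\<And>a. a \<in> A \<Longrightarrow> F a \<in> V" "x \<in> pm.span A"
  shows "F x \<in> V"
proof -
  interpret F: Vector_Spaces.linear pm_scale pm_scale F by fact
  show ?thesis
    using assms(4)
    by (induction rule: pm.span_induct_alt)
      (simp_all add: F.zero F.add F.scale assms(3) pm.subspace_0[OF assms(2)]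
        pm.subspace_add[OF assms(2)] pm.subspace_scale[OF assms(2)])
qed

abbreviation pperm_span :: "'k::field parsym set" where
  "pperm_span \<equiv> pm.span {H \<pi> | \<pi>. partial_permutation \<pi>}"

lemma H_in_pperm_span: "partial_permutation \<pi> \<Longrightarrow> H \<pi> \<in> pperm_span"
  by (rule pm.span_base) blast

lemma pperm_span_mult_closed: "x \<in> pperm_span \<Longrightarrow> y \<in> pperm_span \<Longrightarrow> x * y \<in> pperm_span"
  by (rule span_mult_closed)
    (auto simp: H_mult partial_permutation_add intro!: H_in_pperm_span)

lemma prod_list_H_in_pperm_span:
  "\<forall>\<rho>\<in>set \<rho>s. partial_permutation \<rho> \<Longrightarrow> prod_list (map H \<rho>s) \<in> pperm_span"
  by (induction \<rho>s)
    (simp_all add: pperm_span_mult_closed H_in_pperm_span partial_permutation_zero flip: H_zero)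

text \<open>Peels off one irreducible factor at a time, matching how coproduct and antipode are
  given: by a formula on irreducibles and by (anti)multiplicativity elsewhere.\<close>

lemma partial_permutation_induct [consumes 1, case_names zero add]:
  assumes "partial_permutation \<pi>"
    and "P 0"
    and "\<And>\<sigma> \<tau>. \<sigma> \<in> irreducibles \<Longrightarrow> partial_permutation \<sigma> \<Longrightarrow> P \<tau> \<Longrightarrow> P (\<sigma> + \<tau>)"
  shows "P \<pi>"
proof -
  have "set xs \<subseteq> irreducibles \<Longrightarrow> partial_permutation (sum_list xs) \<Longrightarrow> P (sum_list xs)" for xs
    by (induction xs) (simp_all add: assms(2,3) partial_permutation_add)
  then show ?thesis using factors[of \<pi>] assms(1) by metis
qed

lemma coproduct_H_in_tensor_square:
  assumes "partial_permutation \<pi>"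
  shows "(coproduct (H \<pi>) :: 'k::field parsym2) \<in> tensor_square pperm_span"
proof -
  let ?D = "coproduct :: 'k parsym \<Rightarrow> 'k parsym2"
  have D: "is_coproduct ?D" by (rule is_coproduct_coproduct)
  have tensor: "(tensor (H \<sigma>) (H \<tau>) :: 'k parsym2) \<in> tensor_square pperm_span"
    if "partial_permutation \<sigma>" "partial_permutation \<tau>" for \<sigma> \<tau>
    using that unfolding tensor_square_def by (blast intro: pm.span_base H_in_pperm_span)
  have irr: "?D (H \<sigma>) \<in> tensor_square pperm_span"
    if "\<sigma> \<in> irreducibles" "partial_permutation \<sigma>" for \<sigma>
  proof -
    let ?I = "{(G1, G2). (G1 = 0 \<or> tensor_irreducible G1) \<and>
             (G2 = 0 \<or> tensor_irreducible G2) \<and> G1 \<bullet> G2 = \<sigma>}"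
    have "?D (H \<sigma>) = (\<Sum>(G1, G2)\<in>?I. tensor (H G1) (H G2))"
      using D that(1) unfolding is_coproduct_def irreducibles_def by blast
    \<comment> \<open>Both factors of each pair are partial permutations by
      \<open>partial_permutation_bulletD\<close>, so every summand is a generator of the tensor
      square.\<close>
    also have "\<dots> \<in> tensor_square pperm_span"
      unfolding tensor_square_def
    proof (rule pm.span_sum, clarify, fold tensor_square_def)
      fix G1 G2 assume "\<sigma> = G1 \<bullet> G2"
      then have "partial_permutation (G1 \<bullet> G2)" using that(2) by simp
      then show "(tensor (H G1) (H G2) :: 'k parsym2) \<in> tensor_square pperm_span"
        by (intro tensor partial_permutation_bulletD(1)[of G1 G2] partial_permutation_bulletD(2)[of G1 G2])
    qed
    finally show ?thesis .
  qed
  from assms show ?thesis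
  proof (induction rule: partial_permutation_induct)
    case zero
    show ?case using D tensor partial_permutation_zero by (simp add: is_coproduct_def)
  next
    case (add \<sigma> \<tau>)
    have "?D (H (\<sigma> + \<tau>)) = ?D (H \<sigma>) * ?D (H \<tau>)"
      using D by (simp add: is_coproduct_def flip: H_mult)
    with add irr show ?case by (simp add: tensor_square_mult_closed pperm_span_mult_closed)
  qed
qed

lemma antipode_H_in_pperm_span:
  assumes "partial_permutation \<pi>"
  shows "(antipode (H \<pi>) :: 'k::field parsym) \<in> pperm_span"
proof -
  let ?S = "antipode :: 'k parsym \<Rightarrow> 'k parsym"
  have S: "is_antipode ?S" by (rule is_antipode_antipode)
  have irr: "?S (H \<sigma>) \<in> pperm_span"
    if "\<sigma> \<in> irreducibles" "partial_permutation \<sigma>" for \<sigma>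
  proof -
    have "?S (H \<sigma>) = (\<Sum>\<rho>s \<in> {\<rho>s. 0 \<notin> set \<rho>s \<and> foldr (\<bullet>) \<rho>s 0 = \<sigma>}.
        pm_scale ((-1) ^ length \<rho>s) (prod_list (map H \<rho>s)))"
      using S that(1) unfolding is_antipode_def irreducibles_def by blast
    \<comment> \<open>Every entry of a tuple is a partial permutation, so each summand is a scaled
      product of elements of the span.\<close>
    also have "\<dots> \<in> pperm_span"
      using that(2)
      by (auto intro!: pm.span_sum pm.span_scale prod_list_H_in_pperm_span
          dest: partial_permutation_foldr_bulletD)
    finally show ?thesis .
  qed
  from assms show ?thesis
  proof (induction rule: partial_permutation_induct)
    case zero
    show ?case
      using S H_in_pperm_span[OF partial_permutation_zero] by (simp add: is_antipode_def)
  next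
    case (add \<sigma> \<tau>)
    \<comment> \<open>The reversed order is harmless, since the span is closed under products in
      either order.\<close>
    have "?S (H (\<sigma> + \<tau>)) = ?S (H \<tau>) * ?S (H \<sigma>)"
      using S by (simp add: is_antipode_def flip: H_mult)
    with add irr show ?case by (simp add: pperm_span_mult_closed)
  qed
qed

theorem theorem4p4:
  shows "hopf_subalgebra
    (pm.span {H \<pi> | \<pi>. partial_permutation \<pi>} :: 'k::field parsym set)"
  unfolding hopf_subalgebra_def
proof (intro conjI ballI)
  have linear: "Vector_Spaces.linear pm_scale pm_scale (coproduct :: 'k parsym \<Rightarrow> 'k parsym2)"
    "Vector_Spaces.linear pm_scale pm_scale (antipode :: 'k parsym \<Rightarrow> 'k parsym)"
    using is_coproduct_coproduct is_antipode_antipode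
    by (auto simp: is_coproduct_def is_antipode_def)
  show "pm.subspace (pperm_span :: 'k parsym set)" by (rule pm.subspace_span)
  show "H 0 \<in> (pperm_span :: 'k parsym set)"
    by (rule H_in_pperm_span[OF partial_permutation_zero])
  fix x :: "'k parsym" assume x: "x \<in> pperm_span"
  show "x * y \<in> pperm_span" if "y \<in> pperm_span" for y
    using x that by (rule pperm_span_mult_closed)
  have "pm.subspace (tensor_square (pperm_span :: 'k parsym set))"
    unfolding tensor_square_def by (rule pm.subspace_span)
  then show "coproduct x \<in> tensor_square pperm_span"
    by (rule linear_image_span_subset[OF linear(1) _ _ x])
      (auto intro: coproduct_H_in_tensor_square)
  show "antipode x \<in> pperm_span"
    by (rule linear_image_span_subset[OF linear(2) pm.subspace_span _ x])
      (auto intro: antipode_H_in_pperm_span)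
qed

end
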